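(* Let $K\subseteq\mathbb{R}$ be an open invex set with respect to $\eta:K\times K\to\mathbb{R}$, and let $a,b\in K$ with $a<a+\eta(b,a)$. Suppose that $f:K\to\mathbb{R}$ is a differentiable function such that $f'\in L[a,a+\eta(b,a)]$. If $|f'|$ is prequasiinvex on $K$ with respect to $\eta$, then for every $\alpha>0$, $$\left|\frac{f(a)+f(a+\eta(b,a))}{2}-\frac{\Gamma(\alpha+1)}{2\,\eta(b,a)^{\alpha}}\left[J_{a^{+}}^{\alpha}f\big(a+\eta(b,a)\big)+J_{(a+\eta(b,a))^{-}}^{\alpha}f(a)\right]\right|\le\frac{\eta(b,a)}{\alpha+1}\left(1-\frac{1}{2^{\alpha}}\right)\max\{|f'(a)|,|f'(b)|\}.$$
   Context: A set $K\subseteq\mathbb{R}$ is invex with respect to $\eta:K\times K\to\mathbb{R}$ if $x+t\eta(y,x)\in K$ for all $x,y\in K$ and $t\in[0,1]$. A function $g:K\to\mathbb{R}$ on an invex set $K$ is prequasiinvex with respect to $\eta$ if $g(x+t\eta(y,x))\le\max\{g(x),g(y)\}$ for all $x,y\in K$ and $t\in[0,1]$. $L[c,d]$ denotes the Lebesgue integrable functions on $[c,d]$ (for a function with larger domain, its restriction is meant). For $f\in L[c,d]$ and $\alpha>0$ the Riemann–Liouville fractional integrals are $$J_{c^{+}}^{\alpha}f(x)=\frac{1}{\Gamma(\alpha)}\int_c^x (x-t)^{\alpha-1}f(t)\,dt\ (x>c),\qquad J_{d^{-}}^{\alpha}f(x)=\frac{1}{\Gamma(\alpha)}\int_x^d (t-x)^{\alpha-1}f(t)\,dt\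 (x<d),$$ where $\Gamma$ is the Gamma function. Here they are used with $c=a$ and $d=a+\eta(b,a)$. *)

theory Defs
  imports "HOL-Analysis.Analysis"
begin

(* Functions on K (or on K x K) are represented by total functions, of which only the
   values on K matter.  The bifunction eta is curried. *)

definition invex_set :: "real set \<Rightarrow> (real \<Rightarrow> real \<Rightarrow> real) \<Rightarrow> bool" where
  "invex_set K \<eta> \<longleftrightarrow> (\<forall>x\<in>K. \<forall>y\<in>K. \<forall>t\<in>{0..1}. x + t * \<eta> y x \<in> K)"

definition prequasiinvex_on ::
    "real set \<Rightarrow> (real \<Rightarrow> real \<Rightarrow> real) \<Rightarrow> (real \<Rightarrow> real) \<Rightarrow> bool" where
  "prequasiinvex_on K \<eta> g \<longleftrightarrow> invex_set K \<eta> \<and>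
     (\<forall>x\<in>K. \<forall>y\<in>K. \<forall>t\<in>{0..1}. g (x + t * \<eta> y x) \<le> max (g x) (g y))"

(* Riemann-Liouville integrals based at the left end c and at the right end d.  For
   \<alpha> < 1 the kernel is singular at t = x, where powr returns 0; also 0 powr 0 = 0, which
   concerns \<alpha> = 1.  The single point t = x is a null set, so the integrals are unaffected. *)

definition RL_integral_left :: "real \<Rightarrow> real \<Rightarrow> (real \<Rightarrow> real) \<Rightarrow> real \<Rightarrow> real" where
  "RL_integral_left \<alpha> c f x =
     1 / Gamma \<alpha> * (LINT t:{c..x}|lebesgue. (x - t) powr (\<alpha> - 1) * f t)"

definition RL_integral_right :: "real \<Rightarrow> real \<Rightarrow> (real \<Rightarrow> real) \<Rightarrow> real \<Rightarrow> real" where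
  "RL_integral_right \<alpha> d f x =
     1 / Gamma \<alpha> * (LINT t:{x..d}|lebesgue. (t - x) powr (\<alpha> - 1) * f t)"

end

theory Submission
  imports Defs
begin

text \<open>
  Only the Lipschitz bound $|f(x) - f(y)| \le M |x - y|$ on $[a, d]$ with $d = a + \eta(b,a)$ is used,
  where $M = \max\{|f'(a)|, |f'(b)|\}$; it follows from prequasiinvexity and the mean value inequality.
  With $e = d - a$, both fractional integrals become integrals against $s^{\alpha-1}$ on $[0,e]$, and since
  $\int_0^e s^{\alpha-1}\,ds = e^\alpha/\alpha$, the quantity to be estimated is
  $\frac{\alpha}{2e^\alpha} \int_0^e s^{\alpha-1} (f(a) + f(d) - f(a+s) - f(d-s))\,ds$.
  Pairing $a$ with either $a+s$ or $d-s$, the bracket is at most $2M\min\{s, e-s\}$, and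
  the remaining integral is explicit.
\<close>

text \<open>The reflection \<open>s = x - t\<close> moves the singularity of the kernel to
  \<open>s = 0\<close>, so that the left and right integrals share the weight
  \<open>s powr (\<alpha> - 1)\<close>.\<close>

lemma RL_integral_left_eq:
  "RL_integral_left \<alpha> c f x =
     1 / Gamma \<alpha> * (LINT s:{0..x - c}|lebesgue. s powr (\<alpha> - 1) * f (x - s))"
proof -
  have "(LINT t:{c..x}|lebesgue. (x - t) powr (\<alpha> - 1) * f t)
      = (LINT s|lebesgue. indicator {c..x} (x - s) *\<^sub>R (s powr (\<alpha> - 1) * f (x - s)))"
    unfolding set_lebesgue_integral_def
    by (subst lebesgue_integral_real_affine[where c = "-1" and t = x]) auto
  also have "\<dots> = (LINT s:{0..x - c}|lebesgue. s powr (\<alpha> - 1) * f (x - s))"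
    unfolding set_lebesgue_integral_def
    by (intro Bochner_Integration.integral_cong) (auto simp: indicator_def)
  finally show ?thesis
    by (simp add: RL_integral_left_def)
qed

lemma RL_integral_right_eq:
  "RL_integral_right \<alpha> d f x =
     1 / Gamma \<alpha> * (LINT s:{0..d - x}|lebesgue. s powr (\<alpha> - 1) * f (x + s))"
proof -
  have "(LINT t:{x..d}|lebesgue. (t - x) powr (\<alpha> - 1) * f t)
      = (LINT s|lebesgue. indicator {x..d} (x + s) *\<^sub>R (s powr (\<alpha> - 1) * f (x + s)))"
    unfolding set_lebesgue_integral_def
    by (subst lebesgue_integral_real_affine[where c = 1 and t = x]) auto
  also have "\<dots> = (LINT s:{0..d - x}|lebesgue. s powr (\<alpha> - 1) * f (x + s))"
    unfolding set_lebesgue_integral_def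
    by (intro Bochner_Integration.integral_cong) (auto simp: indicator_def)
  finally show ?thesis
    by (simp add: RL_integral_right_def)
qed

lemma has_integral_powr_minus_one:
  fixes \<alpha> c :: real
  assumes "\<alpha> > 0" "c \<ge> 0"
  shows "((\<lambda>s. s powr (\<alpha> - 1)) has_integral (c powr \<alpha> / \<alpha>)) {0..c}"
  using has_integral_powr_from_0[of "\<alpha> - 1" c] assms by simp

text \<open>For \<alpha> < 1 the weight is unbounded near 0, so the product need not be continuous;
  it is a bounded measurable factor times an integrable nonnegative one.\<close>

lemma absolutely_integrable_powr_mult_continuous:
  fixes g :: "real \<Rightarrow> real" and \<alpha> e :: real
  assumes "\<alpha> > 0" "e \<ge> 0" "continuous_on {0..e} g"
  shows "(\<lambda>s. s powr (\<alpha> - 1) * g s) absolutely_integrable_on {0..e}"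
proof -
  have "(\<lambda>s. g s * s powr (\<alpha> - 1)) absolutely_integrable_on {0..e}"
  proof (rule absolutely_integrable_bounded_measurable_product_real)
    show "g \<in> borel_measurable (lebesgue_on {0..e})"
      using assms(3) by (rule continuous_imp_measurable_on_sets_lebesgue) simp
    show "bounded (g ` {0..e})"
      using assms(3) by (intro compact_imp_bounded compact_continuous_image) auto
    show "(\<lambda>s. s powr (\<alpha> - 1)) absolutely_integrable_on {0..e}"
      using has_integral_powr_minus_one[OF assms(1,2)]
      by (intro nonnegative_absolutely_integrable_1) (auto simp: integrable_on_def)
  qed simp
  then show ?thesis
    by (simp add: mult.commute)
qed

text \<open>This integral produces the constant of the theorem: the kink of the tent at
  \<open>e/2\<close> is the source of the factor \<open>1 - 1 / 2 powr \<alpha>\<close>.\<close>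

lemma has_integral_powr_mult_tent:
  fixes \<alpha> e :: real
  assumes \<alpha>: "\<alpha> > 0" and e: "e > 0"
  shows "((\<lambda>s. s powr (\<alpha> - 1) * min s (e - s)) has_integral
           e * e powr \<alpha> * (1 - 1 / 2 powr \<alpha>) / (\<alpha> * (\<alpha> + 1))) {0..e}"
proof -
  have p: "((\<lambda>s. s powr (\<alpha> - 1) * s) has_integral c * c powr \<alpha> / (\<alpha> + 1)) {0..c}"
    if "c \<ge> 0" for c :: real
  proof -
    \<comment> \<open>The endpoint \<open>s = 0\<close> is included: both sides vanish there, since
      \<open>0 powr r = 0\<close> for every \<open>r\<close>.\<close>
    have "s powr (\<alpha> - 1) * s = s powr \<alpha>" if "s \<in> {0..c}" for s :: real
      using that \<alpha> powr_mult_base[of s "\<alpha> - 1"] by (simp add: mult.commute)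
    moreover have "c * c powr \<alpha> = c powr (\<alpha> + 1)"
      using that powr_mult_base[of c \<alpha>] by (simp add: add.commute)
    moreover have "((\<lambda>s. s powr \<alpha>) has_integral c powr (\<alpha> + 1) / (\<alpha> + 1)) {0..c}"
      using has_integral_powr_from_0[of \<alpha> c] \<alpha> that by simp
    ultimately show ?thesis
      by (metis (no_types, lifting) has_integral_eq)
  qed
  note q = has_integral_powr_minus_one[OF \<alpha>]
  have whole: "((\<lambda>s. s powr (\<alpha> - 1) * (e - s)) has_integral
      e * (e powr \<alpha> / \<alpha>) - e * e powr \<alpha> / (\<alpha> + 1)) {0..e}"
    using has_integral_diff[OF has_integral_mult_right[OF q[of e], of e] p[of e]] e
    by (simp add: algebra_simps)
  have half: "((\<lambda>s. s powr (\<alpha> - 1) * (e - 2 * s)) has_integral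
      e * ((e/2) powr \<alpha> / \<alpha>) - 2 * (e/2 * (e/2) powr \<alpha> / (\<alpha> + 1))) {0..e/2}"
    using has_integral_diff[OF has_integral_mult_right[OF q[of "e/2"], of e]
        has_integral_mult_right[OF p[of "e/2"], of 2]] e
    by (simp add: algebra_simps)
  \<comment> \<open>\<open>min s (e - s) = (e - s) - max 0 (e - 2 * s)\<close>, so that only integrals from \<open>0\<close> occur\<close>
  have half': "((\<lambda>s. if s \<in> {0..e/2} then s powr (\<alpha> - 1) * (e - 2 * s) else 0) has_integral
      e * ((e/2) powr \<alpha> / \<alpha>) - 2 * (e/2 * (e/2) powr \<alpha> / (\<alpha> + 1))) {0..e}"
    using half e by (subst has_integral_restrict) auto
  have "((\<lambda>s. s powr (\<alpha> - 1) * min s (e - s)) has_integral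
      (e * (e powr \<alpha> / \<alpha>) - e * e powr \<alpha> / (\<alpha> + 1))
      - (e * ((e/2) powr \<alpha> / \<alpha>) - 2 * (e/2 * (e/2) powr \<alpha> / (\<alpha> + 1)))) {0..e}"
    by (rule has_integral_eq[OF _ has_integral_diff[OF whole half']])
      (auto simp: min_def algebra_simps)
  moreover have "(e * (e powr \<alpha> / \<alpha>) - e * e powr \<alpha> / (\<alpha> + 1))
      - (e * ((e/2) powr \<alpha> / \<alpha>) - 2 * (e/2 * (e/2) powr \<alpha> / (\<alpha> + 1)))
      = e * e powr \<alpha> * (1 - 1 / 2 powr \<alpha>) / (\<alpha> * (\<alpha> + 1))"
  proof -
    \<comment> \<open>After partial fractions, and with \<open>2 powr \<alpha>\<close> pulled out of
      \<open>(e/2) powr \<alpha>\<close>, both sides are polynomials in the same reciprocals and a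
      ring identity remains.\<close>
    have u: "X / (\<alpha> * (\<alpha> + 1)) = X * (1 / \<alpha> - 1 / (\<alpha> + 1))" for X :: real
      using \<alpha> by (simp add: diff_frac_eq)
    have h: "(e/2) powr \<alpha> = e powr \<alpha> / 2 powr \<alpha>"
      using e by (simp add: powr_divide)
    have s: "2 * (e / 2 * z / y) = e * z / y" for z y :: real
      by simp
    show ?thesis
      unfolding u h s by (simp only: divide_inverse mult_1_left algebra_simps)
  qed
  ultimately show ?thesis
    by simp
qed

text \<open>Continuity gives integrability against the singular weight; the Lipschitz bound gives
  the size of the error.\<close>

lemma fractional_trapezoid_lipschitz:
  fixes f :: "real \<Rightarrow> real" and a d M \<alpha> :: real
  assumes "a < d" and \<alpha>: "\<alpha> > 0"
    and lip: "\<And>x y. x \<in> {a..d} \<Longrightarrow> y \<in> {a..d} \<Longrightarrow> \<bar>f x - f y\<bar> \<le> M * \<bar>x - y\<bar>"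
    and cont: "continuous_on {a..d} f"
  shows "\<bar>(f a + f d) / 2 - Gamma (\<alpha> + 1) / (2 * (d - a) powr \<alpha>)
            * (RL_integral_left \<alpha> a f d + RL_integral_right \<alpha> d f a)\<bar>
         \<le> (d - a) / (\<alpha> + 1) * (1 - 1 / 2 powr \<alpha>) * M"
proof -
  define e where "e = d - a"
  have e: "e > 0" and d: "d = a + e"
    using assms(1) by (auto simp: e_def)
  define L where "L = integral {0..e} (\<lambda>s. s powr (\<alpha> - 1) * f (d - s))"
  define R where "R = integral {0..e} (\<lambda>s. s powr (\<alpha> - 1) * f (a + s))"
  \<comment> \<open>The weighted bracket is kept expanded so that it can be integrated term by term;
    it is factored only for the pointwise estimate \<open>bound\<close>.\<close>
  define D where "D = (\<lambda>s. s powr (\<alpha> - 1) * (f a + f d) - s powr (\<alpha> - 1) * f (d - s)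
                         - s powr (\<alpha> - 1) * f (a + s))"
  have absL: "(\<lambda>s. s powr (\<alpha> - 1) * f (d - s)) absolutely_integrable_on {0..e}"
    using e by (intro absolutely_integrable_powr_mult_continuous \<alpha>
        continuous_on_compose2[OF cont] continuous_intros) (auto simp: d)
  have absR: "(\<lambda>s. s powr (\<alpha> - 1) * f (a + s)) absolutely_integrable_on {0..e}"
    using e by (intro absolutely_integrable_powr_mult_continuous \<alpha>
        continuous_on_compose2[OF cont] continuous_intros) (auto simp: d)
  \<comment> \<open>Absolute integrability identifies the Lebesgue integral with the gauge integral
    \<open>L\<close>.\<close>
  have L: "RL_integral_left \<alpha> a f d = 1 / Gamma \<alpha> * L"
    using set_lebesgue_integral_eq_integral(2)[OF absL]
    by (simp add: RL_integral_left_eq L_def e_def)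
  have R: "RL_integral_right \<alpha> d f a = 1 / Gamma \<alpha> * R"
    using set_lebesgue_integral_eq_integral(2)[OF absR]
    by (simp add: RL_integral_right_eq R_def e_def)
  \<comment> \<open>The functional equation lets \<open>Gamma (\<alpha> + 1)\<close> cancel the
    prefactors \<open>1 / Gamma \<alpha>\<close>, leaving \<alpha>.\<close>
  have G: "Gamma (\<alpha> + 1) = \<alpha> * Gamma \<alpha>" "Gamma \<alpha> \<noteq> 0"
    using \<alpha> Gamma_plus1[of \<alpha>] less_imp_neq[OF Gamma_real_pos[OF \<alpha>]]
    by (auto simp: nonpos_Ints_def)
  have D: "(D has_integral e powr \<alpha> / \<alpha> * (f a + f d) - L - R) {0..e}"
    unfolding D_def L_def R_def using e \<alpha> absL absR
    by (intro has_integral_diff has_integral_mult_left has_integral_powr_minus_one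
        integrable_integral set_lebesgue_integral_eq_integral(1)) auto
  have bound: "\<bar>D s\<bar> \<le> 2 * M * (s powr (\<alpha> - 1) * min s (e - s))" if "s \<in> {0..e}" for s
  proof -
    \<comment> \<open>The first line pairs each endpoint with the point at distance \<open>s\<close>
      from it, the second with the point at distance \<open>e - s\<close>.\<close>
    have "\<bar>f a - f (a + s)\<bar> \<le> M * s" "\<bar>f d - f (d - s)\<bar> \<le> M * s"
      "\<bar>f a - f (d - s)\<bar> \<le> M * (e - s)" "\<bar>f d - f (a + s)\<bar> \<le> M * (e - s)"
      using lip[of a "a + s"] lip[of d "d - s"] lip[of a "d - s"] lip[of d "a + s"] that
      by (auto simp: d)
    then have "\<bar>f a + f d - f (d - s) - f (a + s)\<bar> \<le> 2 * (M * s)"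
      "\<bar>f a + f d - f (d - s) - f (a + s)\<bar> \<le> 2 * (M * (e - s))"
      by linarith+
    then have "\<bar>f a + f d - f (d - s) - f (a + s)\<bar> \<le> 2 * M * min s (e - s)"
      by (simp add: min_def mult.assoc)
    then have "s powr (\<alpha> - 1) * \<bar>f a + f d - f (d - s) - f (a + s)\<bar>
        \<le> s powr (\<alpha> - 1) * (2 * M * min s (e - s))"
      by (rule mult_left_mono) simp
    moreover have "\<bar>D s\<bar> = s powr (\<alpha> - 1) * \<bar>f a + f d - f (d - s) - f (a + s)\<bar>"
    proof -
      have "D s = s powr (\<alpha> - 1) * (f a + f d - f (d - s) - f (a + s))"
        by (simp add: D_def algebra_simps)
      then show ?thesis
        by (simp add: abs_mult)
    qed
    ultimately show ?thesis
      by (simp add: mult_ac)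
  qed
  have T: "((\<lambda>s. 2 * M * (s powr (\<alpha> - 1) * min s (e - s))) has_integral
      2 * M * (e * e powr \<alpha> * (1 - 1 / 2 powr \<alpha>) / (\<alpha> * (\<alpha> + 1)))) {0..e}"
    by (intro has_integral_mult_right has_integral_powr_mult_tent \<alpha> e)
  have "\<bar>e powr \<alpha> / \<alpha> * (f a + f d) - L - R\<bar>
      \<le> 2 * M * (e * e powr \<alpha> * (1 - 1 / 2 powr \<alpha>) / (\<alpha> * (\<alpha> + 1)))"
    using integral_norm_bound_integral[of D "{0..e}"
        "\<lambda>s. 2 * M * (s powr (\<alpha> - 1) * min s (e - s))"] bound
      has_integral_integrable_integral[THEN iffD1, OF D]
      has_integral_integrable_integral[THEN iffD1, OF T] by simp
  \<comment> \<open>The factor is the reciprocal of twice the total mass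
    \<open>e powr \<alpha> / \<alpha>\<close> of the weight; it turns the constant term into
    \<open>(f a + f d) / 2\<close>.\<close>
  then have "\<alpha> / (2 * e powr \<alpha>) * \<bar>e powr \<alpha> / \<alpha> * (f a + f d) - L - R\<bar>
      \<le> \<alpha> / (2 * e powr \<alpha>) * (2 * M * (e * e powr \<alpha> * (1 - 1 / 2 powr \<alpha>) / (\<alpha> * (\<alpha> + 1))))"
    using \<alpha> by (intro mult_left_mono) auto
  moreover have "\<alpha> / (2 * e powr \<alpha>)
        * (2 * M * (e * e powr \<alpha> * (1 - 1 / 2 powr \<alpha>) / (\<alpha> * (\<alpha> + 1))))
      = e / (\<alpha> + 1) * (1 - 1 / 2 powr \<alpha>) * M"
    using \<alpha> e by simp
  moreover have "(f a + f d) / 2 - Gamma (\<alpha> + 1) / (2 * e powr \<alpha>)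
        * (RL_integral_left \<alpha> a f d + RL_integral_right \<alpha> d f a)
      = \<alpha> / (2 * e powr \<alpha>) * (e powr \<alpha> / \<alpha> * (f a + f d) - L - R)"
  proof -
    \<comment> \<open>The Gamma value and the power are replaced by nonzero variables, which leaves
      a rational identity.\<close>
    have "x / 2 - \<alpha> * g / (2 * P) * (1 / g * L + 1 / g * R) = \<alpha> / (2 * P) * (P / \<alpha> * x - L - R)"
      if "P \<noteq> 0" "g \<noteq> 0" for x g P :: real
      using that \<alpha> by (simp add: field_simps)
    then show ?thesis
      unfolding L R G(1) using e G(2) by simp
  qed
  ultimately show ?thesis
    using \<alpha> by (simp add: abs_mult flip: e_def)
qed

theorem theorem8:
  fixes K :: "real set" and \<eta> :: "real \<Rightarrow> real \<Rightarrow> real"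
    and f :: "real \<Rightarrow> real" and a b \<alpha> :: real
  assumes "open K" and "invex_set K \<eta>"
    and "a \<in> K" and "b \<in> K" and "a < a + \<eta> b a"
    and "f differentiable_on K"
    and "set_integrable lebesgue {a..a + \<eta> b a} (deriv f)"
    and "prequasiinvex_on K \<eta> (\<lambda>x. \<bar>deriv f x\<bar>)"
    and "\<alpha> > 0"
  shows "\<bar>(f a + f (a + \<eta> b a)) / 2
            - Gamma (\<alpha> + 1) / (2 * \<eta> b a powr \<alpha>)
              * (RL_integral_left \<alpha> a f (a + \<eta> b a)
                 + RL_integral_right \<alpha> (a + \<eta> b a) f a)\<bar>
         \<le> \<eta> b a / (\<alpha> + 1) * (1 - 1 / 2 powr \<alpha>) * max \<bar>deriv f a\<bar> \<bar>deriv f b\<bar>"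
proof -
  define d where "d = a + \<eta> b a"
  define M where "M = max \<bar>deriv f a\<bar> \<bar>deriv f b\<bar>"
  have ad: "a < d" and e: "\<eta> b a = d - a"
    using assms(5) by (auto simp: d_def)
  have K: "x \<in> K" and M: "\<bar>deriv f x\<bar> \<le> M" if "x \<in> {a..d}" for x
  proof -
    \<comment> \<open>\<open>t\<close> is the parameter of \<open>x\<close> on the path
      \<open>a + t * \<eta> b a\<close>, which sweeps out \<open>{a..d}\<close>. Hence
      \<open>b\<close> enters the bound through prequasiinvexity even if it lies outside this
      segment.\<close>
    define t where "t = (x - a) / (d - a)"
    have t: "t \<in> {0..1}" and x: "x = a + t * \<eta> b a"
      using that ad by (auto simp: t_def e)
    show "x \<in> K"
      using assms(2-4) t unfolding x invex_set_def by blast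
    show "\<bar>deriv f x\<bar> \<le> M"
      using assms(3,4,8) t unfolding x M_def prequasiinvex_on_def by blast
  qed
  have der: "(f has_field_derivative deriv f x) (at x within {a..d})" if "x \<in> {a..d}" for x
  proof -
    \<comment> \<open>Openness of \<open>K\<close> gives two-sided differentiability also at the
      endpoints \<open>a\<close> and \<open>d\<close>, so that \<open>deriv f\<close> is the true
      derivative there.\<close>
    have "f differentiable at x"
      using assms(1,6) K[OF that] by (metis at_within_open differentiable_on_def)
    then show ?thesis
      by (simp add: DERIV_deriv_iff_real_differentiable has_field_derivative_at_within)
  qed
  have "\<bar>f x - f y\<bar> \<le> M * \<bar>x - y\<bar>" if "x \<in> {a..d}" "y \<in> {a..d}" for x y
    \<comment> \<open>Mean value inequality on the convex set \<open>{a..d}\<close>.\<close>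
    using field_differentiable_bound[of "{a..d}" f "deriv f" M x y] der M that by simp
  moreover have "continuous_on {a..d} f"
    using der by (rule DERIV_continuous_on)
  ultimately show ?thesis
    using fractional_trapezoid_lipschitz[of a d \<alpha> f M] ad assms(9)
    unfolding e M_def by (simp add: d_def)
qed

end
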